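(* Let $k\ge1$ and let $c_1,\dots,c_k$ be non-negative integers with $c_k>0$ and $\gcd\{m:c_m\ne0\}=1$, let $P(x)=x^k-c_1x^{k-1}-\cdots-c_k$, and let $r$ be the principal root of $P(x)$. Let $\beta_1,\dots,\beta_k$ be real numbers, not all zero, and $Q_0(x)=\beta_1x^{k-1}+\beta_2x^{k-2}+\cdots+\beta_{k-1}x+\beta_k$. Then the Zeroing Algorithm with input $\beta_1,\dots,\beta_k$ terminates if and only if $Q_0(r)<0$.
   Context: A root is principal if it is a positive root of multiplicity one whose magnitude is strictly greater than that of every other root; for $P$ as in the claim it exists and is unique. Zeroing Algorithm: starting from $Q_0(x)$, define for $t\ge1$ the polynomials $Q_t(x)=x\,Q_{t-1}(x)-q(1,t-1)P(x)$, where $q(n,t)$ denotes the coefficient of $x^{k-n}$ in $Q_t(x)$ for $1\le n\le k$ (each $Q_t$ has degree at most $k-1$). The algorithm terminates at step $t$ if $Q_t(x)$ has no positive coefficients; it terminates if this happens for some $t\ge0$. *)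

theory Defs
  imports Complex_Main "HOL-Computational_Algebra.Polynomial"
begin

definition char_P :: "nat \<Rightarrow> (nat \<Rightarrow> nat) \<Rightarrow> real poly" where
  "char_P k c = monom 1 k - (\<Sum>m = 1..k. monom (real (c m)) (k - m))"

text \<open>The roots of a real polynomial are its complex roots, counted with multiplicity over the
  complex numbers; the principal root itself is a (positive) real number.\<close>

definition principal_root :: "real poly \<Rightarrow> real \<Rightarrow> bool" where
  "principal_root p r \<longleftrightarrow>
     (let pc = map_poly complex_of_real p in
       0 < r \<and> poly pc (complex_of_real r) = 0 \<and> order (complex_of_real r) pc = 1 \<and>
       (\<forall>z. poly pc z = 0 \<and> z \<noteq> complex_of_real r \<longrightarrow> cmod z < cmod (complex_of_real r)))"

definition input_Q :: "nat \<Rightarrow> (nat \<Rightarrow> real) \<Rightarrow> real poly" where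
  "input_Q k \<beta> = (\<Sum>n = 1..k. monom (\<beta> n) (k - n))"

text \<open>The coefficient \<open>q(1,t)\<close> of \<open>Q\<^sub>t\<close> is the one of \<open>x\<^sup>k\<^sup>-\<^sup>1\<close>.
  The subtraction \<open>k - 1\<close> is genuine only for \<open>k \<ge> 1\<close>.\<close>

primrec zeroing_Q :: "nat \<Rightarrow> (nat \<Rightarrow> nat) \<Rightarrow> (nat \<Rightarrow> real) \<Rightarrow> nat \<Rightarrow> real poly" where
  "zeroing_Q k c \<beta> 0 = input_Q k \<beta>"
| "zeroing_Q k c \<beta> (Suc t) =
     monom 1 1 * zeroing_Q k c \<beta> t - smult (coeff (zeroing_Q k c \<beta> t) (k - 1)) (char_P k c)"

definition terminates_at :: "nat \<Rightarrow> (nat \<Rightarrow> nat) \<Rightarrow> (nat \<Rightarrow> real) \<Rightarrow> nat \<Rightarrow> bool" where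
  "terminates_at k c \<beta> t \<longleftrightarrow> (\<forall>i. \<not> coeff (zeroing_Q k c \<beta> t) i > 0)"

definition zeroing_terminates :: "nat \<Rightarrow> (nat \<Rightarrow> nat) \<Rightarrow> (nat \<Rightarrow> real) \<Rightarrow> bool" where
  "zeroing_terminates k c \<beta> \<longleftrightarrow> (\<exists>t. terminates_at k c \<beta> t)"

end

theory Submission
  imports Defs
begin

text \<open>Write \<open>a\<^sub>t = q(1,t)\<close>. Modulo \<open>P\<close> the algorithm multiplies by \<open>x\<close>, so \<open>Q\<^sub>t(r) = r\<^sup>t Q\<^sub>0(r)\<close>; moreover
  \<open>Q\<^sub>t\<close> never vanishes because \<open>P(0) \<noteq> 0\<close>. Hence termination forces \<open>Q\<^sub>0(r) < 0\<close>.
  Conversely, \<open>b\<^sub>t = a\<^sub>t / r\<^sup>t\<close> satisfies an averaging recurrence \<open>b\<^sub>t = \<Sum>\<^sub>m p\<^sub>m b\<^sub>t\<^sub>-\<^sub>m\<close> with weights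
  \<open>p\<^sub>m = c\<^sub>m / r\<^sup>m\<close> of sum 1, and the coefficients of \<open>Q\<^sub>t\<close> are non-negative combinations of the \<open>a\<^sub>s\<close>
  with \<open>s < t\<close>. If \<open>Q\<^sub>0(r) < 0\<close>, then the invariant \<open>Q\<^sub>t(r) / r\<^sup>t\<close> makes each window of length \<open>k\<close>
  contain some \<open>b\<^sub>s \<le> -\<eta>\<close>. As the indices \<open>m\<close> with \<open>p\<^sub>m > 0\<close> generate all large integers, that value
  contributes a fixed proportion to each \<open>b\<^sub>t\<close> a bounded time later, which contracts the upper
  bound of the \<open>b\<^sub>t\<close> geometrically towards \<open>-\<eta>\<close>.\<close>

section \<open>Additive monoids of natural numbers generated by a set of gcd 1\<close>

inductive_set sums_of :: "nat set \<Rightarrow> nat set" for S where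
  zero: "0 \<in> sums_of S"
| add: "s \<in> sums_of S \<Longrightarrow> m \<in> S \<Longrightarrow> s + m \<in> sums_of S"

lemma sums_of_add:
  assumes "y \<in> sums_of S" "x \<in> sums_of S"
  shows "x + y \<in> sums_of S"
  using assms(1)
proof induction
  case zero
  then show ?case using assms(2) by simp
next
  case (add s m)
  then show ?case using sums_of.add[of "x + s" S m] by (simp add: add.assoc)
qed

lemma sums_of_mult: "x \<in> sums_of S \<Longrightarrow> n * x \<in> sums_of S"
  by (induction n) (auto intro: sums_of.zero sums_of_add)

text \<open>Bezout without negative coefficients: the gcd is realised as a difference of two sums,
  the negative terms being collected in \<open>y\<close>. Each new generator is merged by the
  two-term Bezout identity.\<close>

lemma sums_of_Gcd_diff:
  assumes "finite F" "F \<subseteq> S"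
  shows "\<exists>x\<in>sums_of S. \<exists>y\<in>sums_of S. x = y + Gcd F"
  using assms
proof (induction F rule: finite_induct)
  case empty
  then show ?case using sums_of.zero by auto
next
  case (insert m F)
  then obtain x y where xy: "x \<in> sums_of S" "y \<in> sums_of S" "x = y + Gcd F" by auto
  have m: "m \<in> sums_of S"
    using sums_of.add[OF sums_of.zero, of m S] insert.prems by simp
  define g where "g = Gcd F"
  have G: "Gcd (insert m F) = gcd m g" by (simp add: g_def)
  obtain d u v where d: "d dvd m" "d dvd g" "m * u = g * v + d \<or> g * u = m * v + d"
    using bezout_add_nat[of m g] by metis
  have "d = gcd m g"
  proof (rule dvd_antisym)
    show "d dvd gcd m g" using d by simp
    have "gcd m g dvd m * u" "gcd m g dvd g * v" "gcd m g dvd g * u" "gcd m g dvd m * v"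
      by (simp_all)
    then show "gcd m g dvd d" using d(3) by (metis dvd_add_right_iff)
  qed
  with d(3) consider "m * u = g * v + gcd m g" | "g * u = m * v + gcd m g" by auto
  then show ?case
  proof cases
    \<comment> \<open>Each of the \<open>v\<close> copies of \<open>g\<close> is traded for the
      difference \<open>x - y\<close>; the other case does the same with \<open>u\<close>
      copies.\<close>
    case 1
    have "u * m + v * y = v * x + gcd m g" using 1 xy(3)
      by (simp add: g_def algebra_simps)
    moreover have "u * m + v * y \<in> sums_of S" "v * x \<in> sums_of S"
      using xy m by (auto intro: sums_of_add sums_of_mult)
    ultimately show ?thesis unfolding G by blast
  next
    case 2
    have "u * x = (u * y + v * m) + gcd m g" using 2 xy(3)
      by (simp add: g_def algebra_simps)
    moreover have "u * x \<in> sums_of S" "u * y + v * m \<in> sums_of S"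
      using xy m by (auto intro: sums_of_add sums_of_mult)
    ultimately show ?thesis unfolding G by blast
  qed
qed

text \<open>Gcd 1 yields consecutive elements \<open>y\<close> and \<open>y + 1\<close>. Once
  \<open>n \<ge> y * y\<close>, the quotient of \<open>n\<close> by \<open>y\<close> is at least the
  remainder \<open>e\<close>, so \<open>e\<close> of the copies of \<open>y\<close> can be raised to
  \<open>y + 1\<close>.\<close>

lemma sums_of_cofinite:
  assumes "finite S" "Gcd S = 1"
  shows "\<exists>N. \<forall>n\<ge>N. n \<in> sums_of S"
proof -
  obtain y where y: "y \<in> sums_of S" "y + 1 \<in> sums_of S"
    using sums_of_Gcd_diff[OF assms(1) order.refl] assms(2) by auto
  have "n \<in> sums_of S" if "n \<ge> y * y" for n
  proof (cases "y = 0")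
    case True
    then show ?thesis using sums_of_mult[OF y(2), of n] by simp
  next
    case False
    have "n mod y < y" using False by simp
    moreover have "y \<le> n div y" using that False by (simp add: less_eq_div_iff_mult_less_eq)
    ultimately have le: "n mod y \<le> n div y" by simp
    define a e where "a = n div y" and "e = n mod y"
    have "a = (a - e) + e" using le by (simp add: a_def e_def)
    moreover have "n = a * y + e" by (simp add: a_def e_def)
    ultimately have "n = (a - e) * y + e * (y + 1)"
      by (metis add.assoc distrib_left distrib_right mult_1_right)
    moreover have "(a - e) * y + e * (y + 1) \<in> sums_of S"
      using y by (intro sums_of_add[OF sums_of_mult sums_of_mult])
    ultimately show ?thesis by metis
  qed
  then show ?thesis by blast
qed

section \<open>Sequences in which each term is a weighted mean of the \<open>k\<close> preceding
  ones\<close>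

locale averaging =
  fixes k :: nat and p b :: "nat \<Rightarrow> real"
  assumes p_nonneg: "m \<in> {1..k} \<Longrightarrow> 0 \<le> p m"
    and p_sum: "(\<Sum>m=1..k. p m) = 1"
    and recurrence: "k \<le> t \<Longrightarrow> b t = (\<Sum>m=1..k. p m * b (t - m))"
begin

lemma bounded_above: "\<exists>B. \<forall>t. b t \<le> B"
proof -
  define B where "B = Max (insert 0 (b ` {..<k}))"
  have "b t \<le> B" for t
  proof (induction t rule: less_induct)
    case (less t)
    show ?case
    proof (cases "t < k")
      case True
      then show ?thesis by (simp add: B_def)
    next
      case False
      then have "b t = (\<Sum>m=1..k. p m * b (t - m))" by (simp add: recurrence)
      also have "\<dots> \<le> (\<Sum>m=1..k. p m * B)"
        using False by (intro sum_mono mult_left_mono less p_nonneg) auto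
      also have "\<dots> = B" using p_sum by (simp flip: sum_distrib_right)
      finally show ?thesis .
    qed
  qed
  then show ?thesis by blast
qed

lemma step_bound:
  assumes m: "m \<in> {1..k}" and M: "\<And>u. u \<ge> T \<Longrightarrow> b u \<le> M" and t: "t \<ge> T + k"
  shows "b t \<le> p m * b (t - m) + (1 - p m) * M"
proof -
  have "b t = (\<Sum>m=1..k. p m * b (t - m))" using t by (simp add: recurrence)
  also have "\<dots> = p m * b (t - m) + (\<Sum>i\<in>{1..k}-{m}. p i * b (t - i))"
    using m by (simp add: sum.remove)
  also have "(\<Sum>i\<in>{1..k}-{m}. p i * b (t - i)) \<le> (\<Sum>i\<in>{1..k}-{m}. p i * M)"
    using t by (intro sum_mono mult_left_mono M p_nonneg) auto
  also have "\<dots> = (1 - p m) * M"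
    using p_sum m by (simp add: sum.remove[of _ m] flip: sum_distrib_right)
  finally show ?thesis by simp
qed

text \<open>Iterates \<open>step_bound\<close> along the summands of \<open>s\<close>, so
  \<open>w\<close> is the product of their weights. It is quantified before \<open>T\<close>,
  \<open>M\<close> and \<open>t\<close> because the contraction needs a weight depending on the lag
  alone.\<close>

lemma delayed_bound:
  assumes "s \<in> sums_of {m\<in>{1..k}. p m \<noteq> 0}"
  shows "\<exists>w>0. \<forall>T M t. (\<forall>u\<ge>T. b u \<le> M) \<longrightarrow> T + s + k \<le> t \<longrightarrow> b t \<le> w * b (t - s) + (1 - w) * M"
  using assms
proof induction
  case zero
  show ?case by (intro exI[of _ 1]) auto
next
  case (add s m)
  then obtain w where w: "w > 0" "\<And>T M t. (\<forall>u\<ge>T. b u \<le> M) \<Longrightarrow> T + s + k \<le> t \<Longrightarrow>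
      b t \<le> w * b (t - s) + (1 - w) * M" by blast
  have m: "m \<in> {1..k}" "p m > 0" using add.hyps p_nonneg[of m] by auto
  have "b t \<le> w * p m * b (t - (s + m)) + (1 - w * p m) * M"
    if M: "\<forall>u\<ge>T. b u \<le> M" and t: "T + (s + m) + k \<le> t" for T M t
  proof -
    have "b t \<le> w * b (t - s) + (1 - w) * M" using M t by (intro w(2)[of T]) auto
    also have "b (t - s) \<le> p m * b (t - s - m) + (1 - p m) * M"
      using t by (intro step_bound[OF m(1), of T] M[rule_format]) auto
    finally show ?thesis using w(1) by (simp add: algebra_simps mult_left_mono)
  qed
  then show ?case using w(1) m(2) by (intro exI[of _ "w * p m"]) auto
qed

lemma eventually_negative:
  assumes gcd: "Gcd {m\<in>{1..k}. p m \<noteq> 0} = 1"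
    and \<eta>: "\<eta> > 0" and window: "\<And>t. k \<le> t \<Longrightarrow> \<exists>s\<in>{t - k..<t}. b s \<le> - \<eta>"
  shows "\<exists>T. \<forall>t\<ge>T. b t < 0"
proof -
  obtain N where N: "\<And>n. n \<ge> N \<Longrightarrow> n \<in> sums_of {m\<in>{1..k}. p m \<noteq> 0}"
    using sums_of_cofinite[OF _ gcd] by auto
  then have "\<forall>s\<in>{N..N + k}. \<exists>w>0. \<forall>T M t. (\<forall>u\<ge>T. b u \<le> M) \<longrightarrow> T + s + k \<le> t \<longrightarrow>
      b t \<le> w * b (t - s) + (1 - w) * M"
    using delayed_bound by simp
  then obtain W where W: "\<And>s. s \<in> {N..N + k} \<Longrightarrow> W s > 0"
    "\<And>s T M t. s \<in> {N..N + k} \<Longrightarrow> (\<forall>u\<ge>T. b u \<le> M) \<Longrightarrow> T + s + k \<le> t \<Longrightarrow>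
      b t \<le> W s * b (t - s) + (1 - W s) * M"
    unfolding bchoice_iff by metis
  \<comment> \<open>A single weight for all lags in the finite range; inserting 1 gives
    \<open>w \<le> 1\<close>, which keeps the powers of \<open>1 - w\<close> non-negative.\<close>
  define w where "w = Min (insert 1 (W ` {N..N + k}))"
  have w: "0 < w" "w \<le> 1" "\<And>s. s \<in> {N..N + k} \<Longrightarrow> w \<le> W s"
    unfolding w_def using W(1) by (auto simp: Min_gr_iff intro: Min_le simp del: Min_insert)
  \<comment> \<open>The low value used lies at most \<open>N + k\<close> before \<open>t\<close>,
    and \<open>delayed_bound\<close> asks for another \<open>k\<close> terms above
    \<open>T\<close>.\<close>
  define L where "L = N + 2 * k"
  have contraction: "b t \<le> M - w * (\<eta> + M)"
    if M: "\<forall>u\<ge>T. b u \<le> M" and M\<eta>: "M \<ge> - \<eta>" and t: "T + L \<le> t" for T M t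
  proof -
    \<comment> \<open>The window is taken to end \<open>N\<close> steps before \<open>t\<close>, so
      that the lag \<open>t - s\<close> is large enough to be a sum of indices of positive
      weight.\<close>
    have "k \<le> t - N" using t by (simp add: L_def)
    then obtain s where s: "s \<in> {t - N - k..<t - N}" "b s \<le> - \<eta>"
      using window by blast
    have in_range: "t - s \<in> {N..N + k}" and ts: "t - (t - s) = s" "T + (t - s) + k \<le> t"
      using s(1) t by (auto simp: L_def)
    have "b t \<le> W (t - s) * b s + (1 - W (t - s)) * M"
      using W(2)[OF in_range M ts(2)] ts(1) by simp
    also have "\<dots> \<le> W (t - s) * (- \<eta>) + (1 - W (t - s)) * M"
      using W(1)[OF in_range] s(2) by (intro add_right_mono mult_left_mono) auto
    also have "\<dots> = M - W (t - s) * (\<eta> + M)" by (simp add: algebra_simps)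
    also have "\<dots> \<le> M - w * (\<eta> + M)"
      using w(3)[OF in_range] M\<eta> by (intro diff_left_mono mult_right_mono) auto
    finally show ?thesis .
  qed
  obtain B where B: "\<And>t. b t \<le> B" using bounded_above by blast
  \<comment> \<open>The maximum with 0 keeps every later bound at least \<open>- \<eta>\<close>, as
    \<open>contraction\<close> demands; the excess over \<open>- \<eta>\<close> then shrinks by
    \<open>1 - w\<close> every \<open>L\<close> steps.\<close>
  define K where "K = max 0 (B + \<eta>)"
  have geometric: "\<forall>t\<ge>n * L. b t \<le> (1 - w) ^ n * K - \<eta>" for n
  proof (induction n)
    case 0
    have "B \<le> K - \<eta>" by (simp add: K_def)
    then show ?case using B order_trans by auto
  next
    case (Suc n)
    have "(1 - w) ^ n * K \<ge> 0" using w by (simp add: K_def)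
    then show ?case using contraction[OF Suc] by (auto simp: algebra_simps)
  qed
  have "(\<lambda>n. (1 - w) ^ n * K - \<eta>) \<longlonglongrightarrow> 0 * K - \<eta>"
    using w by (intro tendsto_intros LIMSEQ_power_zero) auto
  then have "\<forall>\<^sub>F n in sequentially. (1 - w) ^ n * K - \<eta> < 0"
    using \<eta> by (intro order_tendstoD) auto
  then obtain n where "(1 - w) ^ n * K - \<eta> < 0"
    by (auto simp: eventually_sequentially)
  then show ?thesis using geometric[of n] by (meson le_less_trans)
qed

end

section \<open>The principal root and the coefficients of the characteristic and input
  polynomials\<close>

lemma principal_rootD:
  assumes "principal_root P r"
  shows "r > 0" "poly P r = 0"
proof -
  show "r > 0" using assms by (simp add: principal_root_def Let_def)
  have "complex_of_real (poly P r) = poly (map_poly complex_of_real P) (complex_of_real r)"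
    by (simp add: poly_altdef degree_map_poly coeff_map_poly)
  also have "\<dots> = 0"
    using assms by (simp add: principal_root_def Let_def)
  finally have "complex_of_real (poly P r) = 0" .
  then show "poly P r = 0" by simp
qed

lemma coeff_char_P:
  assumes "i < k"
  shows "coeff (char_P k c) i = - real (c (k - i))"
proof -
  have "(\<Sum>m=1..k. if k - m = i then real (c m) else 0) = (\<Sum>m\<in>{k - i}. real (c m))"
    using assms by (intro sum.mono_neutral_cong_right) auto
  then show ?thesis using assms by (simp add: char_P_def coeff_sum)
qed

lemma coeff_char_P_ge:
  assumes "i \<ge> k"
  shows "coeff (char_P k c) i = (if i = k then 1 else 0)"
proof -
  have "(\<Sum>m=1..k. if k - m = i then real (c m) else 0) = 0"
    using assms by (intro sum.neutral) auto
  then show ?thesis by (simp add: char_P_def coeff_sum)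
qed

lemma coeff_input_Q: "1 \<le> n \<Longrightarrow> n \<le> k \<Longrightarrow> coeff (input_Q k \<beta>) (k - n) = \<beta> n"
proof -
  assume n: "1 \<le> n" "n \<le> k"
  have "(\<Sum>m=1..k. if k - m = k - n then \<beta> m else 0) = (\<Sum>m\<in>{n}. \<beta> m)"
    using n by (intro sum.mono_neutral_cong_right) auto
  then show ?thesis by (simp add: input_Q_def coeff_sum)
qed

section \<open>The polynomials of the algorithm and the two directions of the equivalence\<close>

context
  fixes k :: nat and c :: "nat \<Rightarrow> nat" and \<beta> :: "nat \<Rightarrow> real"
  assumes k: "k \<ge> 1"
begin

abbreviation "Q \<equiv> zeroing_Q k c \<beta>"
abbreviation "lead t \<equiv> coeff (Q t) (k - 1)"

text \<open>Since \<open>char_P k c\<close> is monic of degree \<open>k\<close>, the subtraction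
  cancels exactly the term of degree \<open>k\<close> created by multiplying by x.\<close>

lemma coeff_zeroing_Q_ge: "i \<ge> k \<Longrightarrow> coeff (Q t) i = 0"
proof (induction t arbitrary: i)
  case 0
  then show ?case by (auto simp: input_Q_def coeff_sum intro!: sum.neutral)
next
  case (Suc t)
  obtain j where j: "i = Suc j" using Suc.prems k by (cases i) auto
  show ?case
  proof (cases "i = k")
    case True
    then show ?thesis using j by (simp add: coeff_monom_mult coeff_char_P_ge)
  next
    case False
    then show ?thesis using j Suc by (simp add: coeff_monom_mult coeff_char_P_ge)
  qed
qed

text \<open>Each step shifts coefficients up by one and adds \<open>c (k - d) * lead t\<close> at
  degree \<open>d\<close>. With \<open>d \<le> t\<close> the unrolling reaches degree 0 before it
  reaches the input polynomial.\<close>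

lemma coeff_zeroing_Q:
  assumes "d \<le> t" "d < k"
  shows "coeff (Q (Suc t)) d = (\<Sum>i\<le>d. real (c (k - i)) * lead (t - (d - i)))"
  using assms
proof (induction d arbitrary: t)
  case 0
  then show ?case by (simp add: coeff_monom_mult coeff_char_P)
next
  case (Suc d)
  then obtain u where u: "t = Suc u" by (cases t) auto
  have "coeff (Q (Suc t)) (Suc d) = coeff (Q t) d + real (c (k - Suc d)) * lead t"
    using Suc.prems by (simp add: coeff_monom_mult coeff_char_P)
  also have "coeff (Q t) d = (\<Sum>i\<le>d. real (c (k - i)) * lead (u - (d - i)))"
    unfolding u using Suc u by (intro Suc.IH) auto
  also have "\<dots> = (\<Sum>i\<le>d. real (c (k - i)) * lead (t - (Suc d - i)))"
    by (intro sum.cong) (auto simp: u Suc_diff_le)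
  finally show ?case by simp
qed

lemma lead_recurrence:
  assumes "k \<le> t"
  shows "lead t = (\<Sum>m=1..k. real (c m) * lead (t - m))"
proof -
  obtain u where u: "t = Suc u" using assms k by (cases t) auto
  \<comment> \<open>The case \<open>d = k - 1\<close> of the coefficient formula; the substitution
    \<open>m = k - i\<close> then gives the recurrence.\<close>
  have "lead t = (\<Sum>i\<le>k - 1. real (c (k - i)) * lead (u - (k - 1 - i)))"
    unfolding u using assms u k by (intro coeff_zeroing_Q) auto
  also have "\<dots> = (\<Sum>m=1..k. real (c m) * lead (t - m))"
    using assms u k by (intro sum.reindex_bij_witness[of _ "\<lambda>m. k - m" "\<lambda>i. k - i"]) auto
  finally show ?thesis .
qed

lemma poly_zeroing_Q:
  assumes "poly (char_P k c) r = 0"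
  shows "poly (Q t) r = r ^ t * poly (input_Q k \<beta>) r"
  using assms by (induction t) (auto simp: poly_monom algebra_simps)

lemma poly_zeroing_Q_sum: "poly (Q t) x = (\<Sum>d<k. coeff (Q t) d * x ^ d)"
proof -
  have "degree (Q t) \<le> k - 1" using coeff_zeroing_Q_ge by (intro degree_le) auto
  then have "poly (Q t) x = (\<Sum>d\<le>k - 1. coeff (Q t) d * x ^ d)"
    unfolding poly_altdef by (intro sum.mono_neutral_left) (auto simp: coeff_eq_0)
  also have "{..k - 1} = {..<k}" using k by auto
  finally show ?thesis .
qed

text \<open>The constant coefficient of \<open>Q (Suc t)\<close> is \<open>c k * lead t\<close>. If
  it vanishes, nothing is subtracted and \<open>Q (Suc t)\<close> is x times the non-zero
  \<open>Q t\<close>.\<close>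

lemma zeroing_Q_neq_0:
  assumes "c k > 0" "\<exists>n\<in>{1..k}. \<beta> n \<noteq> 0"
  shows "Q t \<noteq> 0"
proof (induction t)
  case 0
  then show ?case using assms(2) coeff_input_Q[of _ k \<beta>] by fastforce
next
  case (Suc t)
  show ?case
  proof
    assume *: "Q (Suc t) = 0"
    then have "coeff (Q (Suc t)) 0 = 0" by simp
    then have "lead t = 0" using assms(1) k by (simp add: coeff_monom_mult coeff_char_P)
    then have "Q t = 0" using * by simp
    then show False using Suc by simp
  qed
qed

lemma terminates_imp_negative:
  assumes "r > 0" "poly (char_P k c) r = 0" "c k > 0" "\<exists>n\<in>{1..k}. \<beta> n \<noteq> 0"
    and "zeroing_terminates k c \<beta>"
  shows "poly (input_Q k \<beta>) r < 0"
proof -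
  obtain t where t: "\<And>i. coeff (Q t) i \<le> 0"
    using assms(5) by (auto simp: zeroing_terminates_def terminates_at_def not_less)
  obtain d where d: "coeff (Q t) d \<noteq> 0" using zeroing_Q_neq_0[OF assms(3,4), of t]
    by (auto simp: poly_eq_iff)
  then have "d < k"
    using coeff_zeroing_Q_ge by (metis not_le)
  have "poly (Q t) r < (\<Sum>d<k. 0)"
    unfolding poly_zeroing_Q_sum
  proof (rule sum_strict_mono_ex1)
    show "\<forall>d\<in>{..<k}. coeff (Q t) d * r ^ d \<le> 0"
      using t assms(1) by (simp add: mult_nonpos_nonneg)
    have "coeff (Q t) d * r ^ d < 0"
      using t[of d] d assms(1) by (simp add: mult_neg_pos)
    then show "\<exists>d\<in>{..<k}. coeff (Q t) d * r ^ d < 0" using \<open>d < k\<close> by auto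
  qed simp
  then have "r ^ t * poly (input_Q k \<beta>) r < 0"
    using poly_zeroing_Q[OF assms(2)] by simp
  then show ?thesis using assms(1) by (simp add: mult_less_0_iff)
qed

text \<open>If all leading coefficients in a window exceeded \<open>- \<eta> * r ^ s\<close>, the
  coefficient formula would push \<open>Q t\<close> at \<open>r\<close> above its known value
  \<open>r ^ t * poly (input_Q k \<beta>) r\<close>.\<close>

lemma lead_window:
  assumes r: "r > 0" "poly (char_P k c) r = 0" and neg: "poly (input_Q k \<beta>) r < 0"
  shows "\<exists>\<eta>>0. \<forall>t\<ge>k. \<exists>s\<in>{t - k..<t}. lead s / r ^ s \<le> - \<eta>"
proof -
  \<comment> \<open>The value of \<open>poly (Q t) r / r ^ t\<close> when \<open>lead s\<close> is
    replaced by \<open>r ^ s\<close> in the coefficient formula.\<close>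
  define C where "C = (\<Sum>d<k. \<Sum>i\<le>d. real (c (k - i)) * r ^ i / r)"
  have C: "C \<ge> 0" unfolding C_def using r by (intro sum_nonneg) auto
  \<comment> \<open>Dividing by \<open>C + 1\<close> instead of \<open>C\<close> makes the
    inequality with \<open>- \<eta> * C\<close> strict and covers \<open>C = 0\<close>.\<close>
  define \<eta> where "\<eta> = - poly (input_Q k \<beta>) r / (C + 1)"
  have \<eta>: "\<eta> > 0" "- \<eta> * C > poly (input_Q k \<beta>) r"
    using C neg by (auto simp: \<eta>_def field_simps)
  have "\<exists>s\<in>{t - k..<t}. lead s / r ^ s \<le> - \<eta>" if t: "t \<ge> k" for t
  proof (rule ccontr)
    assume "\<not> ?thesis"
    then have large: "lead s \<ge> - \<eta> * r ^ s" if "s \<in> {t - k..<t}" for s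
      using that r(1) pos_less_divide_eq[of "r ^ s" "- \<eta>" "lead s"]
      by (meson less_imp_le not_le zero_less_power)
    obtain u where u: "t = Suc u" using t k by (cases t) auto
    have "r ^ t * (- \<eta> * C) \<le> poly (Q t) r"
      unfolding C_def poly_zeroing_Q_sum sum_distrib_left
    proof (rule sum_mono)
      fix d assume "d \<in> {..<k}"
      then have d: "d < k" "d \<le> u" using t u by auto
      have "(\<Sum>i\<le>d. r ^ t * (- \<eta> * (real (c (k - i)) * r ^ i / r)))
          = (\<Sum>i\<le>d. real (c (k - i)) * (- \<eta> * r ^ (u - (d - i))) * r ^ d)"
      proof (rule sum.cong)
        fix i assume i: "i \<in> {..d}"
        have "r ^ (u - (d - i)) * r ^ d = r ^ u * r ^ i"
          using i d by (simp flip: power_add)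
        then show "r ^ t * (- \<eta> * (real (c (k - i)) * r ^ i / r))
          = real (c (k - i)) * (- \<eta> * r ^ (u - (d - i))) * r ^ d"
          using r by (simp add: u)
      qed simp
      also have "\<dots> \<le> (\<Sum>i\<le>d. real (c (k - i)) * lead (u - (d - i)) * r ^ d)"
        using r t u d by (intro sum_mono mult_right_mono mult_left_mono large) auto
      also have "\<dots> = coeff (Q t) d * r ^ d"
        using coeff_zeroing_Q[OF d(2,1)] by (simp add: u sum_distrib_right)
      finally show "(\<Sum>i\<le>d. r ^ t * (- \<eta> * (real (c (k - i)) * r ^ i / r))) \<le> coeff (Q t) d * r ^ d" .
    qed
    then have "- \<eta> * C \<le> poly (input_Q k \<beta>) r"
      using r(1) unfolding poly_zeroing_Q[OF r(2)] by (simp only: mult_le_cancel_left_pos zero_less_power)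
    then show False using \<eta>(2) by simp
  qed
  then show ?thesis using \<eta>(1) by blast
qed

lemma negative_imp_terminates:
  assumes r: "r > 0" "poly (char_P k c) r = 0" and gcd: "Gcd {m \<in> {1..k}. c m \<noteq> 0} = 1"
    and neg: "poly (input_Q k \<beta>) r < 0"
  shows "zeroing_terminates k c \<beta>"
proof -
  define p where "p m = real (c m) / r ^ m" for m
  define b where "b t = lead t / r ^ t" for t
  interpret averaging k p b
  proof
    show "0 \<le> p m" for m using r by (simp add: p_def)
    \<comment> \<open>The weights sum to 1 because this is the equation P(r) = 0, divided below by
      \<open>r ^ k\<close>.\<close>
    have "r ^ k = (\<Sum>m=1..k. real (c m) * r ^ (k - m))"
      using r(2) by (simp add: char_P_def poly_sum poly_monom)
    also have "\<dots> = r ^ k * (\<Sum>m=1..k. p m)"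
      unfolding sum_distrib_left using r
      by (intro sum.cong) (auto simp: p_def power_diff)
    finally show "(\<Sum>m=1..k. p m) = 1" using r by simp
    show "b t = (\<Sum>m=1..k. p m * b (t - m))" if "k \<le> t" for t
      using that r unfolding b_def lead_recurrence[OF that] sum_divide_distrib
      by (intro sum.cong) (auto simp: p_def power_diff)
  qed
  have "Gcd {m \<in> {1..k}. p m \<noteq> 0} = 1" using r gcd by (simp add: p_def)
  moreover obtain \<eta> where "\<eta> > 0" "\<And>t. k \<le> t \<Longrightarrow> \<exists>s\<in>{t - k..<t}. b s \<le> - \<eta>"
    using lead_window[OF r neg] by (auto simp: b_def)
  ultimately obtain T where "\<And>t. t \<ge> T \<Longrightarrow> b t < 0" using eventually_negative by blast
  then have lead: "t \<ge> T \<Longrightarrow> lead t \<le> 0" for t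
    using r by (force simp: b_def divide_less_0_iff)
  \<comment> \<open>Waiting \<open>k\<close> steps past \<open>T\<close> ensures that every
    \<open>lead s\<close> entering a coefficient has \<open>s \<ge> T\<close>.\<close>
  have "coeff (Q (Suc (T + k))) d \<le> 0" for d
  proof (cases "d < k")
    case True
    then show ?thesis
      by (simp only: coeff_zeroing_Q) (intro sum_nonpos mult_nonneg_nonpos lead, auto)
  next
    case False
    then show ?thesis using coeff_zeroing_Q_ge[of d "Suc (T + k)"] by simp
  qed
  then show ?thesis unfolding zeroing_terminates_def terminates_at_def by (meson not_less)
qed

end

theorem theorem3p3:
  fixes k :: nat and c :: "nat \<Rightarrow> nat" and \<beta> :: "nat \<Rightarrow> real" and r :: real
  assumes "k \<ge> 1"
    and "c k > 0"
    and "Gcd {m \<in> {1..k}. c m \<noteq> 0} = 1"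
    and "principal_root (char_P k c) r"
    and "\<exists>n\<in>{1..k}. \<beta> n \<noteq> 0"
  shows "zeroing_terminates k c \<beta> \<longleftrightarrow> poly (input_Q k \<beta>) r < 0"
  using terminates_imp_negative[OF assms(1) principal_rootD[OF assms(4)] assms(2,5)]
    negative_imp_terminates[OF assms(1) principal_rootD[OF assms(4)] assms(3)] by (rule iffI)

end
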